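(* Let $X$ be a separated (Hausdorff) real topological linear space, let $(Z,\preceq)$ be a preordered set, and let $\Psi$ be a non-empty family of functions $\psi\colon Z\to\mathbb{R}\cup\{\pm\infty\}$ which are monotone with respect to $\preceq$. Let $f\colon X\to\mathcal{P}(Z,\Psi)$ and $\varepsilon_0>0$ be such that $\operatorname{Min}(f,\varepsilon+,\Psi)$ is compact for all $0<\varepsilon\le\varepsilon_0$. Then $\operatorname{Min}(f,0+,\Psi)$ is nonempty and compact, and $\operatorname{Min}(f,\varepsilon+,\Psi)$ Hausdorff converges to $\operatorname{Min}(f,0+,\Psi)$ as $\varepsilon\to0$. If, additionally, $\psi^\triangle\circ f\colon X\to\mathbb{R}\cup\{\pm\infty\}$ is lower semicontinuous for all $\psi\in\Psi$, then $\operatorname{Min}(f,0,\Psi)$ is non-empty and a $(0,\Psi)$-solution of the problem: minimize $f(x)$ over $x\in X$.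
   Context: A function $\psi\colon Z\to\mathbb{R}\cup\{\pm\infty\}$ is monotone if $z_1\preceq z_2$ implies $\psi(z_1)\le\psi(z_2)$. For $D\subseteq Z$, $\psi^\triangle(D)=\inf_{z\in D}\psi(z)$ (with $\inf_{z\in\emptyset}\psi(z)=+\infty$) and $\operatorname{cl}_\Psi D=\bigcap_{\psi\in\Psi}\{z\in Z\mid \psi^\triangle(D)\le\psi(z)\}$; $\mathcal{P}(Z,\Psi)=\{D\subseteq Z\mid D=\operatorname{cl}_\Psi D\}$, ordered by $\supseteq$, is a complete lattice in which $\inf\mathcal{A}=\operatorname{cl}_\Psi\bigcup_{A\in\mathcal{A}}A$. For $M\subseteq X$, $\inf f[M]=\operatorname{cl}_\Psi\bigcup_{x\in M}f(x)$. For $\varepsilon\ge 0$ and $\psi\in\Psi$ put $b_\varepsilon(\psi)=\psi^\triangle(\inf f[X])+\varepsilon$ if $\psi^\triangle(\inf f[X])\ne-\infty$ and $b_\varepsilon(\psi)=-\frac1\varepsilon$ if $\psi^\triangle(\inf f[X])=-\infty$, with the conventions $-\frac10=-\infty$ and $+\infty+\varepsilon=+\infty$. An element $x\in X$ is an $(\varepsilon,\Psi)$-minimizer of $f$ if there exists $\psi\in\Psi$ with $\psi^\triangle(f(x))\le b_\varepsilon(\psi)$; the set of these is $\operatorname{Min}(f,\varepsilon,\Psi)$. An element $x\in X$ is an $(\varepsilon+,\Psi)$-minimizer of $f$ if for all $\delta>0$ there exists $\psi\in\Psi$ with $\psi^\triangle(f(x))\le b_{\varepsilon+\delta}(\psi)$;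 the set of these is $\operatorname{Min}(f,\varepsilon+,\Psi)$. A non-empty set $M\subseteq X$ is a $(0,\Psi)$-solution of the problem if $\psi^\triangle(\inf f[M])\le b_0(\psi)$ for all $\psi\in\Psi$ and $M\subseteq\operatorname{Min}(f,0,\Psi)$. Sets $M_\varepsilon\subseteq X$ Hausdorff converge to $N\subseteq X$ as $\varepsilon\to0$ if for every neighborhood $U$ of $0\in X$ there is $\varepsilon_U>0$ such that $M_\varepsilon\subseteq N+U$ and $N\subseteq M_\varepsilon+U$ for all $0<\varepsilon<\varepsilon_U$. *)

theory Defs
  imports "HOL-Analysis.Analysis" "HOL-Library.Set_Algebras"
begin

text \<open>
  The preordered set is an explicit carrier \<open>Z\<close> with a relation on it, so that the empty
  preordered set is covered. Functions \<open>\<psi>\<close> are total on the type of \<open>Z\<close>, but only their values on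
  \<open>Z\<close> enter the definitions below.
\<close>

definition tri :: "('z \<Rightarrow> ereal) \<Rightarrow> 'z set \<Rightarrow> ereal" where
  "tri \<psi> D = (INF z\<in>D. \<psi> z)"

lemma tri_empty: "tri \<psi> {} = \<infinity>"
  by (simp add: tri_def top_ereal_def)

definition cl :: "'z set \<Rightarrow> ('z \<Rightarrow> ereal) set \<Rightarrow> 'z set \<Rightarrow> 'z set" where
  "cl Z \<Psi> D = {z \<in> Z. \<forall>\<psi>\<in>\<Psi>. tri \<psi> D \<le> \<psi> z}"

definition closed_sets :: "'z set \<Rightarrow> ('z \<Rightarrow> ereal) set \<Rightarrow> 'z set set" where
  "closed_sets Z \<Psi> = {D. D \<subseteq> Z \<and> D = cl Z \<Psi> D}"

definition inf_image :: "'z set \<Rightarrow> ('z \<Rightarrow> ereal) set \<Rightarrow> ('x \<Rightarrow> 'z set) \<Rightarrow> 'x set \<Rightarrow> 'z set" where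
  "inf_image Z \<Psi> f M = cl Z \<Psi> (\<Union>x\<in>M. f x)"

lemma subset_cl: "D \<subseteq> Z \<Longrightarrow> D \<subseteq> cl Z \<Psi> D"
  by (auto simp: cl_def tri_def intro: INF_lower)

lemma cl_mono: "D \<subseteq> E \<Longrightarrow> cl Z \<Psi> D \<subseteq> cl Z \<Psi> E"
  unfolding cl_def tri_def by (auto intro: order_trans[OF INF_superset_mono])

lemma cl_in_closed_sets: "cl Z \<Psi> D \<in> closed_sets Z \<Psi>" if "D \<subseteq> Z"
proof -
  have "tri \<psi> D \<le> tri \<psi> (cl Z \<Psi> D)" if "\<psi> \<in> \<Psi>" for \<psi>
    using that unfolding tri_def[of _ "cl Z \<Psi> D"] by (auto simp: cl_def intro: INF_greatest)
  then have "cl Z \<Psi> (cl Z \<Psi> D) \<subseteq> cl Z \<Psi> D"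
    unfolding cl_def[of _ _ "cl Z \<Psi> D"] by (auto simp: cl_def[of _ _ D] intro: order_trans)
  moreover have "cl Z \<Psi> D \<subseteq> Z" by (auto simp: cl_def)
  ultimately show ?thesis
    using subset_cl[of "cl Z \<Psi> D" Z \<Psi>] unfolding closed_sets_def by blast
qed

text \<open>\<^const>\<open>inf_image\<close> is the infimum of the values of \<open>f\<close> on \<open>M\<close> in the lattice of closed sets
  ordered by reverse inclusion.\<close>

lemma inf_image_is_infimum:
  assumes "\<And>x. x \<in> M \<Longrightarrow> f x \<in> closed_sets Z \<Psi>"
  shows "inf_image Z \<Psi> f M \<in> closed_sets Z \<Psi>"
    and "\<And>x. x \<in> M \<Longrightarrow> inf_image Z \<Psi> f M \<supseteq> f x"
    and "\<And>B. B \<in> closed_sets Z \<Psi> \<Longrightarrow> (\<And>x. x \<in> M \<Longrightarrow> B \<supseteq> f x) \<Longrightarrow> B \<supseteq> inf_image Z \<Psi> f M"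
proof -
  have sub: "(\<Union>x\<in>M. f x) \<subseteq> Z"
    using assms by (auto simp: closed_sets_def)
  show "inf_image Z \<Psi> f M \<in> closed_sets Z \<Psi>"
    unfolding inf_image_def by (rule cl_in_closed_sets[OF sub])
  show "inf_image Z \<Psi> f M \<supseteq> f x" if "x \<in> M" for x
    unfolding inf_image_def using subset_cl[OF sub, of \<Psi>] that by blast
  show "B \<supseteq> inf_image Z \<Psi> f M"
    if "B \<in> closed_sets Z \<Psi>" "\<And>x. x \<in> M \<Longrightarrow> B \<supseteq> f x" for B
    using that cl_mono[of "\<Union>x\<in>M. f x" B Z \<Psi>] unfolding inf_image_def closed_sets_def by blast
qed

text \<open>The case \<open>\<epsilon> = 0\<close> is separated because \<open>-1/0 = -\<infinity>\<close> is wanted here, while division by zero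
  in the reals yields \<open>0\<close>. The convention \<open>\<infinity> + \<epsilon> = \<infinity>\<close> is built into \<^typ>\<open>ereal\<close>.\<close>

definition bound ::
    "'z set \<Rightarrow> ('z \<Rightarrow> ereal) set \<Rightarrow> ('x \<Rightarrow> 'z set) \<Rightarrow> real \<Rightarrow> ('z \<Rightarrow> ereal) \<Rightarrow> ereal" where
  "bound Z \<Psi> f \<epsilon> \<psi> =
     (if tri \<psi> (inf_image Z \<Psi> f UNIV) \<noteq> -\<infinity> then tri \<psi> (inf_image Z \<Psi> f UNIV) + ereal \<epsilon>
      else if \<epsilon> = 0 then -\<infinity> else ereal (- (1 / \<epsilon>)))"

definition minimizers ::
    "'z set \<Rightarrow> ('z \<Rightarrow> ereal) set \<Rightarrow> ('x \<Rightarrow> 'z set) \<Rightarrow> real \<Rightarrow> 'x set" where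
  "minimizers Z \<Psi> f \<epsilon> = {x. \<exists>\<psi>\<in>\<Psi>. tri \<psi> (f x) \<le> bound Z \<Psi> f \<epsilon> \<psi>}"

definition minimizers_plus ::
    "'z set \<Rightarrow> ('z \<Rightarrow> ereal) set \<Rightarrow> ('x \<Rightarrow> 'z set) \<Rightarrow> real \<Rightarrow> 'x set" where
  "minimizers_plus Z \<Psi> f \<epsilon> = {x. \<forall>\<delta>>0. \<exists>\<psi>\<in>\<Psi>. tri \<psi> (f x) \<le> bound Z \<Psi> f (\<epsilon> + \<delta>) \<psi>}"

definition zero_solution ::
    "'z set \<Rightarrow> ('z \<Rightarrow> ereal) set \<Rightarrow> ('x \<Rightarrow> 'z set) \<Rightarrow> 'x set \<Rightarrow> bool" where
  "zero_solution Z \<Psi> f M \<longleftrightarrow>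
     M \<noteq> {} \<and> (\<forall>\<psi>\<in>\<Psi>. tri \<psi> (inf_image Z \<Psi> f M) \<le> bound Z \<Psi> f 0 \<psi>) \<and> M \<subseteq> minimizers Z \<Psi> f 0"

definition hausdorff_converges ::
    "(real \<Rightarrow> 'x::{topological_space, group_add} set) \<Rightarrow> 'x set \<Rightarrow> bool" where
  "hausdorff_converges M N \<longleftrightarrow>
     (\<forall>U. (\<exists>V. open V \<and> 0 \<in> V \<and> V \<subseteq> U) \<longrightarrow>
        (\<exists>\<epsilon>\<^sub>U>0. \<forall>\<epsilon>. 0 < \<epsilon> \<and> \<epsilon> < \<epsilon>\<^sub>U \<longrightarrow> M \<epsilon> \<subseteq> N + U \<and> N \<subseteq> M \<epsilon> + U))"

definition lower_semicontinuous :: "('x::topological_space \<Rightarrow> ereal) \<Rightarrow> bool" where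
  "lower_semicontinuous g \<longleftrightarrow> (\<forall>x a. a < g x \<longrightarrow> (\<forall>\<^sub>F y in nhds x. a < g y))"

end

theory Submission
  imports Defs
begin

text \<open>
  Everything rests on one compactness principle: if compact sets \<open>K \<epsilon>\<close> in a Hausdorff space
  shrink as \<open>\<epsilon>\<close> decreases to \<open>0\<close>, then every open superset of their intersection already contains
  some \<open>K \<epsilon>\<close> (\<open>shrinking_compacts_subset_open\<close>). For the empty open set this says that the
  intersection is nonempty whenever all members are; for the open set \<open>N + V\<close>, where \<open>N\<close> is the
  intersection and \<open>V\<close> a neighbourhood of \<open>0\<close>, it says that \<open>K \<epsilon>\<close> Hausdorff converges to \<open>N\<close>.

  The sets of \<open>(\<epsilon>+,\<Psi>)\<close>-minimizers are such a family, because the bounds \<open>b\<^sub>\<epsilon>(\<psi>)\<close> increase with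
  \<open>\<epsilon>\<close>, and their intersection over \<open>\<epsilon> > 0\<close> is the set of \<open>(0+,\<Psi>)\<close>-minimizers, because
  \<open>\<delta> = \<delta>/2 + \<delta>/2\<close>. No member of the family is empty: for \<open>\<epsilon> > 0\<close> and any \<open>\<psi> \<in> \<Psi>\<close>, either the infimum of
  \<open>\<psi>\<^sup>\<triangle> \<circ> f\<close> is \<open>+\<infinity>\<close> and every point will do, or \<open>b\<^sub>\<epsilon>(\<psi>)\<close> lies strictly above it.

  If the functions \<open>\<psi>\<^sup>\<triangle> \<circ> f\<close> are lower semicontinuous, the principle is applied once more, for each
  \<open>\<psi>\<close> separately, to the sublevel sets \<open>{x. \<psi>\<^sup>\<triangle> (f x) \<le> b\<^sub>\<epsilon>(\<psi>)}\<close>. These are closed subsets of the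
  compact sets above, and a common point of all of them attains the infimum of \<open>\<psi>\<^sup>\<triangle> \<circ> f\<close>, since
  \<open>b\<^sub>\<epsilon>(\<psi>)\<close> tends to \<open>b\<^sub>0(\<psi>)\<close>, which is this infimum. Hence every scalarized problem is solved
  within the \<open>(0,\<Psi>)\<close>-minimizers, which is what being a solution requires.
\<close>

section \<open>Shrinking families of compact sets\<close>

text \<open>Otherwise the traces of the family on the complement of \<open>W\<close> would be nonempty compact sets
  with the finite intersection property, but no common point.\<close>

lemma shrinking_compacts_subset_open:
  fixes K :: "real \<Rightarrow> 'a::t2_space set"
  assumes e0: "0 < e0"
    and mono: "\<And>d e. 0 < d \<Longrightarrow> d \<le> e \<Longrightarrow> K d \<subseteq> K e"
    and compact: "\<And>e. 0 < e \<Longrightarrow> e \<le> e0 \<Longrightarrow> compact (K e)"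
    and W: "open W" "(\<Inter>e\<in>{0<..}. K e) \<subseteq> W"
  shows "\<exists>e. 0 < e \<and> e \<le> e0 \<and> K e \<subseteq> W"
proof (rule ccontr)
  assume no: "\<nexists>e. 0 < e \<and> e \<le> e0 \<and> K e \<subseteq> W"
  have "K e0 \<inter> (\<Inter>e\<in>{0<..e0}. K e - W) \<noteq> {}"
  proof (rule compact_imp_fip_image)
    show "compact (K e0)"
      using compact e0 by simp
    show "closed (K e - W)" if "e \<in> {0<..e0}" for e
      using compact that W(1) by (simp add: closed_Diff compact_imp_closed)
    show "K e0 \<inter> (\<Inter>e\<in>I. K e - W) \<noteq> {}" if I: "finite I" "I \<subseteq> {0<..e0}" for I
    proof -
      define d where "d = Min (insert e0 I)"
      have d: "0 < d" "d \<le> e0" "\<And>e. e \<in> I \<Longrightarrow> d \<le> e"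
        using I e0 by (auto simp: d_def)
      then obtain x where "x \<in> K d" "x \<notin> W"
        using no by blast
      then show ?thesis
        using mono[OF d(1)] d(2,3) by blast
    qed
  qed
  then obtain x where x: "x \<notin> W" "\<And>e. 0 < e \<Longrightarrow> e \<le> e0 \<Longrightarrow> x \<in> K e"
    using e0 by fastforce
  have "x \<in> K e" if "0 < e" for e
    using x(2)[of "min e e0"] mono[of "min e e0" e] that e0 by auto
  then show False
    using x(1) W(2) by blast
qed

lemma shrinking_compacts_Inter_nonempty:
  fixes K :: "real \<Rightarrow> 'a::t2_space set"
  assumes "0 < e0"
    and "\<And>d e. 0 < d \<Longrightarrow> d \<le> e \<Longrightarrow> K d \<subseteq> K e"
    and "\<And>e. 0 < e \<Longrightarrow> e \<le> e0 \<Longrightarrow> compact (K e)"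
    and nonempty: "\<And>e. 0 < e \<Longrightarrow> K e \<noteq> {}"
  shows "(\<Inter>e\<in>{0<..}. K e) \<noteq> {}"
proof
  assume "(\<Inter>e\<in>{0<..}. K e) = {}"
  then obtain e where "0 < e" "K e \<subseteq> {}"
    using shrinking_compacts_subset_open[where K = K, OF assms(1-3) open_empty] by auto
  then show False
    using nonempty by blast
qed

lemma open_set_plus_right:
  fixes N V :: "'a::topological_group_add set"
  assumes "open V"
  shows "open (N + V)"
proof -
  have "N + V = (\<Union>n\<in>N. (\<lambda>y. - n + y) -` V)"
  proof (intro equalityI subsetI)
    fix y assume "y \<in> N + V"
    then obtain n v where "n \<in> N" "v \<in> V" "y = n + v"
      by (rule set_plus_elim)
    then show "y \<in> (\<Union>n\<in>N. (\<lambda>y. - n + y) -` V)"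
      by (intro UN_I[of n]) (simp_all add: add.assoc[symmetric])
  next
    fix y assume "y \<in> (\<Union>n\<in>N. (\<lambda>y. - n + y) -` V)"
    then obtain n where "n \<in> N" "- n + y \<in> V"
      by auto
    then show "y \<in> N + V"
      using set_plus_intro[of n N "- n + y" V] by (simp add: add.assoc[symmetric])
  qed
  moreover have "open ((\<lambda>y. - n + y) -` V)" for n
    by (intro open_vimage assms continuous_intros)
  ultimately show ?thesis
    by (simp add: open_UN)
qed

text \<open>Only \<open>K \<epsilon> \<subseteq> N + U\<close> for small \<open>\<epsilon>\<close> takes compactness. The other inclusion is
  \<open>N \<subseteq> K \<epsilon> \<subseteq> K \<epsilon> + U\<close>.\<close>

lemma shrinking_compacts_hausdorff_converges:
  fixes K :: "real \<Rightarrow> 'a::{t2_space, topological_group_add} set"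
  assumes "0 < e0"
    and mono: "\<And>d e. 0 < d \<Longrightarrow> d \<le> e \<Longrightarrow> K d \<subseteq> K e"
    and "\<And>e. 0 < e \<Longrightarrow> e \<le> e0 \<Longrightarrow> compact (K e)"
  shows "hausdorff_converges K (\<Inter>e\<in>{0<..}. K e)"
  unfolding hausdorff_converges_def
proof (intro allI impI)
  fix U :: "'a set"
  let ?N = "\<Inter>e\<in>{0<..}. K e"
  assume "\<exists>V. open V \<and> 0 \<in> V \<and> V \<subseteq> U"
  then obtain V where V: "open V" "0 \<in> V" "V \<subseteq> U"
    by blast
  have sub: "A \<subseteq> A + V" for A :: "'a set"
    using set_plus_intro[OF _ V(2), of _ A] by auto
  have sub_U: "A + V \<subseteq> A + U" for A :: "'a set"
    using V(3) by (rule set_plus_mono2[OF subset_refl])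
  obtain c where c: "0 < c" "K c \<subseteq> ?N + V"
    using shrinking_compacts_subset_open[where K = K, OF assms open_set_plus_right[OF V(1)] sub[of ?N]]
    by blast
  have "K e \<subseteq> ?N + U \<and> ?N \<subseteq> K e + U" if "0 < e" "e < c" for e
  proof
    show "K e \<subseteq> ?N + U"
      using mono[of e c] that c(2) sub_U[of ?N] by simp
    have "?N \<subseteq> K e"
      using that(1) by blast
    then show "?N \<subseteq> K e + U"
      using sub[of "K e"] sub_U[of "K e"] by blast
  qed
  then show "\<exists>c>0. \<forall>e. 0 < e \<and> e < c \<longrightarrow> K e \<subseteq> ?N + U \<and> ?N \<subseteq> K e + U"
    using c(1) by blast
qed

section \<open>Infima of scalarizations and their relaxations\<close>

lemma tri_antimono: "D \<subseteq> E \<Longrightarrow> tri \<psi> E \<le> tri \<psi> D"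
  unfolding tri_def by (rule INF_superset_mono) auto

text \<open>The closure of \<open>D\<close> admits only points at which no \<open>\<psi> \<in> \<Psi>\<close> falls below its infimum over
  \<open>D\<close>, so it leaves these infima unchanged.\<close>

lemma tri_cl:
  assumes "D \<subseteq> Z" "\<psi> \<in> \<Psi>"
  shows "tri \<psi> (cl Z \<Psi> D) = tri \<psi> D"
proof (rule antisym)
  show "tri \<psi> (cl Z \<Psi> D) \<le> tri \<psi> D"
    by (rule tri_antimono[OF subset_cl[OF assms(1)]])
  show "tri \<psi> D \<le> tri \<psi> (cl Z \<Psi> D)"
    using assms(2) unfolding tri_def[of _ "cl Z \<Psi> D"]
    by (auto simp: cl_def intro: INF_greatest)
qed

lemma tri_inf_image:
  assumes "\<And>x. x \<in> M \<Longrightarrow> f x \<in> closed_sets Z \<Psi>" "\<psi> \<in> \<Psi>"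
  shows "tri \<psi> (inf_image Z \<Psi> f M) = (INF x\<in>M. tri \<psi> (f x))"
proof -
  have "(\<Union>x\<in>M. f x) \<subseteq> Z"
    using assms(1) by (auto simp: closed_sets_def)
  then have "tri \<psi> (inf_image Z \<Psi> f M) = tri \<psi> (\<Union>x\<in>M. f x)"
    unfolding inf_image_def using assms(2) by (rule tri_cl)
  also have "\<dots> = (INF x\<in>M. tri \<psi> (f x))"
  proof (rule antisym)
    show "tri \<psi> (\<Union>x\<in>M. f x) \<le> (INF x\<in>M. tri \<psi> (f x))"
      by (intro INF_greatest tri_antimono) blast
    have "(INF x\<in>M. tri \<psi> (f x)) \<le> \<psi> z" if "x \<in> M" "z \<in> f x" for x z
      using INF_lower[OF that(1), of "\<lambda>x. tri \<psi> (f x)"] INF_lower[OF that(2), of \<psi>]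
      unfolding tri_def by (rule order_trans)
    then show "(INF x\<in>M. tri \<psi> (f x)) \<le> tri \<psi> (\<Union>x\<in>M. f x)"
      unfolding tri_def[of _ "\<Union>x\<in>M. f x"] by (intro INF_greatest) blast
  qed
  finally show ?thesis .
qed

lemma bound_zero: "bound Z \<Psi> f 0 \<psi> = tri \<psi> (inf_image Z \<Psi> f UNIV)"
  by (simp add: bound_def zero_ereal_def[symmetric])

lemma bound_mono:
  assumes "0 \<le> d" "d \<le> e"
  shows "bound Z \<Psi> f d \<psi> \<le> bound Z \<Psi> f e \<psi>"
  using assms by (auto simp: bound_def add_left_mono frac_le)

lemma less_bound:
  assumes "0 < e" "tri \<psi> (inf_image Z \<Psi> f UNIV) \<noteq> \<infinity>"
  shows "tri \<psi> (inf_image Z \<Psi> f UNIV) < bound Z \<Psi> f e \<psi>"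
  using assms by (cases "tri \<psi> (inf_image Z \<Psi> f UNIV)") (auto simp: bound_def)

text \<open>In the limit \<open>\<epsilon> \<rightarrow> 0\<close> the relaxed bounds lose nothing. When the infimum is \<open>-\<infinity>\<close>, this is
  the reason for relaxing it to \<open>-1/\<epsilon>\<close>.\<close>

lemma le_bound_zeroI:
  assumes "\<And>e. 0 < e \<Longrightarrow> a \<le> bound Z \<Psi> f e \<psi>"
  shows "a \<le> bound Z \<Psi> f 0 \<psi>"
proof (cases "tri \<psi> (inf_image Z \<Psi> f UNIV) = -\<infinity>")
  case False
  then have "a \<le> tri \<psi> (inf_image Z \<Psi> f UNIV) + ereal e" if "0 < e" for e
    using assms[OF that] by (simp add: bound_def)
  then show ?thesis
    by (simp add: bound_zero ereal_le_epsilon2)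
next
  case True
  have "a \<le> ereal r" for r
  proof -
    have "a \<le> ereal (- (\<bar>r\<bar> + 1))"
      using assms[of "1 / (\<bar>r\<bar> + 1)"] True by (simp add: bound_def)
    also have "\<dots> \<le> ereal r"
      by simp
    finally show ?thesis .
  qed
  then have "a = -\<infinity>"
    by (rule ereal_bot)
  then show ?thesis
    by simp
qed

text \<open>No strict inequality is available when the infimum is \<open>+\<infinity>\<close>, but then the bound is
  \<open>+\<infinity>\<close> as well.\<close>

lemma ex_le_bound:
  assumes "\<And>x. f x \<in> closed_sets Z \<Psi>" "\<psi> \<in> \<Psi>" "0 < e"
  obtains x where "tri \<psi> (f x) \<le> bound Z \<Psi> f e \<psi>"
proof (cases "tri \<psi> (inf_image Z \<Psi> f UNIV) = \<infinity>")
  case True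
  then show ?thesis
    using that by (simp add: bound_def)
next
  case False
  then have "(INF x. tri \<psi> (f x)) < bound Z \<Psi> f e \<psi>"
    using less_bound[OF assms(3) False] assms(1,2) by (simp add: tri_inf_image)
  then show ?thesis
    using that by (auto simp: INF_less_iff intro: less_imp_le)
qed

section \<open>Approximate minimizers\<close>

lemma minimizers_plus_mono:
  assumes "0 \<le> d" "d \<le> e"
  shows "minimizers_plus Z \<Psi> f d \<subseteq> minimizers_plus Z \<Psi> f e"
proof -
  have "bound Z \<Psi> f (d + t) \<psi> \<le> bound Z \<Psi> f (e + t) \<psi>" if "0 < t" for t \<psi>
    using assms that by (intro bound_mono) auto
  then show ?thesis
    unfolding minimizers_plus_def by (blast intro: order_trans)
qed

lemma minimizers_plus_zero_eq_Inter:
  "minimizers_plus Z \<Psi> f 0 = (\<Inter>e\<in>{0<..}. minimizers_plus Z \<Psi> f e)"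
proof (intro equalityI subsetI)
  fix x assume "x \<in> minimizers_plus Z \<Psi> f 0"
  then show "x \<in> (\<Inter>e\<in>{0<..}. minimizers_plus Z \<Psi> f e)"
    using minimizers_plus_mono[OF order_refl, of _ Z \<Psi> f]
    by (auto intro: subsetD less_imp_le)
next
  fix x assume x: "x \<in> (\<Inter>e\<in>{0<..}. minimizers_plus Z \<Psi> f e)"
  have "\<exists>\<psi>\<in>\<Psi>. tri \<psi> (f x) \<le> bound Z \<Psi> f (0 + d) \<psi>" if "0 < d" for d
  proof -
    have "x \<in> minimizers_plus Z \<Psi> f (d / 2)" "0 < d / 2"
      using x that by auto
    then have "\<exists>\<psi>\<in>\<Psi>. tri \<psi> (f x) \<le> bound Z \<Psi> f (d / 2 + d / 2) \<psi>"
      unfolding minimizers_plus_def by blast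
    then show ?thesis
      by simp
  qed
  then show "x \<in> minimizers_plus Z \<Psi> f 0"
    by (simp add: minimizers_plus_def)
qed

lemma sublevel_subset_minimizers_plus:
  assumes "\<psi> \<in> \<Psi>" "0 \<le> e"
  shows "{x. tri \<psi> (f x) \<le> bound Z \<Psi> f e \<psi>} \<subseteq> minimizers_plus Z \<Psi> f e"
proof -
  have "bound Z \<Psi> f e \<psi> \<le> bound Z \<Psi> f (e + t) \<psi>" if "0 < t" for t
    using assms(2) that by (intro bound_mono) auto
  then show ?thesis
    unfolding minimizers_plus_def using assms(1) by (blast intro: order_trans)
qed

lemma minimizers_plus_nonempty:
  assumes "\<And>x. f x \<in> closed_sets Z \<Psi>" "\<Psi> \<noteq> {}" "0 < e"
  shows "minimizers_plus Z \<Psi> f e \<noteq> {}"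
proof -
  obtain \<psi> where \<psi>: "\<psi> \<in> \<Psi>"
    using assms(2) by blast
  obtain x where "tri \<psi> (f x) \<le> bound Z \<Psi> f e \<psi>"
    using ex_le_bound[OF assms(1) \<psi> assms(3)] .
  then show ?thesis
    using sublevel_subset_minimizers_plus[OF \<psi>, of e f Z] assms(3) by fastforce
qed

lemma closed_sublevel_lower_semicontinuous:
  assumes "lower_semicontinuous g"
  shows "closed {x. g x \<le> a}"
proof -
  have "\<exists>T. open T \<and> x \<in> T \<and> T \<subseteq> {x. a < g x}" if "a < g x" for x
    using assms that unfolding lower_semicontinuous_def eventually_nhds subset_eq mem_Collect_eq
    by blast
  then have "open {x. a < g x}"
    by (subst open_subopen) blast
  moreover have "- {x. a < g x} = {x. g x \<le> a}"
    by (auto simp: not_less)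
  ultimately show ?thesis
    by (metis closed_Compl)
qed

text \<open>Here compactness of the sets of approximate minimizers of the whole problem yields
  attainment for each scalarized problem: its relaxed sublevel sets are closed subsets of them.\<close>

lemma lower_semicontinuous_attains_bound_zero:
  fixes f :: "'x::t2_space \<Rightarrow> 'z set"
  assumes f: "\<And>x. f x \<in> closed_sets Z \<Psi>"
    and \<psi>: "\<psi> \<in> \<Psi>"
    and lsc: "lower_semicontinuous (\<lambda>x. tri \<psi> (f x))"
    and "0 < e0"
    and compact: "\<And>e. 0 < e \<Longrightarrow> e \<le> e0 \<Longrightarrow> compact (minimizers_plus Z \<Psi> f e)"
  obtains x where "tri \<psi> (f x) \<le> bound Z \<Psi> f 0 \<psi>"
proof -
  define L where "L e = {x. tri \<psi> (f x) \<le> bound Z \<Psi> f e \<psi>}" for e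
  have "(\<Inter>e\<in>{0<..}. L e) \<noteq> {}"
  proof (rule shrinking_compacts_Inter_nonempty[OF \<open>0 < e0\<close>])
    show "L d \<subseteq> L e" if "0 < d" "d \<le> e" for d e
      unfolding L_def using bound_mono[of d e Z \<Psi> f \<psi>] that by (auto intro: order_trans)
    show "compact (L e)" if "0 < e" "e \<le> e0" for e
    proof -
      have "closed (L e)"
        unfolding L_def by (rule closed_sublevel_lower_semicontinuous[OF lsc])
      then have "compact (minimizers_plus Z \<Psi> f e \<inter> L e)"
        using compact[OF that] by (simp add: compact_Int_closed)
      moreover have "L e \<subseteq> minimizers_plus Z \<Psi> f e"
        unfolding L_def using that(1) by (intro sublevel_subset_minimizers_plus[OF \<psi>]) simp
      ultimately show ?thesis
        by (simp add: Int_absorb1)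
    qed
    show "L e \<noteq> {}" if "0 < e" for e
      using ex_le_bound[where f = f, OF f \<psi> that] unfolding L_def by blast
  qed
  then obtain x where "\<And>e. 0 < e \<Longrightarrow> x \<in> L e"
    by fastforce
  then have "tri \<psi> (f x) \<le> bound Z \<Psi> f 0 \<psi>"
    by (intro le_bound_zeroI) (simp add: L_def)
  then show ?thesis
    using that by blast
qed

text \<open>Minimizing one scalarization suffices for being a \<open>(0,\<Psi>)\<close>-minimizer, so attainment for every
  \<open>\<psi>\<close> puts all the witnesses into the same set.\<close>

lemma zero_solution_minimizersI:
  assumes f: "\<And>x. f x \<in> closed_sets Z \<Psi>"
    and nonempty: "\<Psi> \<noteq> {}"
    and attained: "\<And>\<psi>. \<psi> \<in> \<Psi> \<Longrightarrow> \<exists>x. tri \<psi> (f x) \<le> bound Z \<Psi> f 0 \<psi>"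
  shows "zero_solution Z \<Psi> f (minimizers Z \<Psi> f 0)"
  unfolding zero_solution_def
proof (intro conjI ballI subset_refl)
  obtain \<psi>0 where \<psi>0: "\<psi>0 \<in> \<Psi>"
    using nonempty by blast
  obtain x0 where "tri \<psi>0 (f x0) \<le> bound Z \<Psi> f 0 \<psi>0"
    using attained[OF \<psi>0] by blast
  then have "x0 \<in> minimizers Z \<Psi> f 0"
    using \<psi>0 by (auto simp: minimizers_def)
  then show "minimizers Z \<Psi> f 0 \<noteq> {}"
    by blast
next
  fix \<psi> assume \<psi>: "\<psi> \<in> \<Psi>"
  obtain x where x: "tri \<psi> (f x) \<le> bound Z \<Psi> f 0 \<psi>"
    using attained[OF \<psi>] by blast
  then have "x \<in> minimizers Z \<Psi> f 0"
    using \<psi> by (auto simp: minimizers_def)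
  then have "tri \<psi> (inf_image Z \<Psi> f (minimizers Z \<Psi> f 0)) \<le> tri \<psi> (f x)"
    unfolding tri_inf_image[OF f \<psi>] by (rule INF_lower)
  then show "tri \<psi> (inf_image Z \<Psi> f (minimizers Z \<Psi> f 0)) \<le> bound Z \<Psi> f 0 \<psi>"
    using x by (rule order_trans)
qed

section \<open>Existence and stability of minimizers\<close>

theorem theorem4p3:
  fixes Z :: "'z set" and le :: "'z \<Rightarrow> 'z \<Rightarrow> bool" and \<Psi> :: "('z \<Rightarrow> ereal) set"
    and f :: "'x::{t2_space, topological_group_add, real_vector} \<Rightarrow> 'z set"
    and \<epsilon>0 :: real
  assumes scaleR_continuous: "continuous_on UNIV (\<lambda>p :: real \<times> 'x. fst p *\<^sub>R snd p)"
    and preorder: "reflp_on Z le" "transp_on Z le"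
    and nonempty: "\<Psi> \<noteq> {}"
    and monotone: "\<forall>\<psi>\<in>\<Psi>. monotone_on Z le (\<le>) \<psi>"
    and f_closed: "\<forall>x. f x \<in> closed_sets Z \<Psi>"
    and eps0: "\<epsilon>0 > 0"
    and compact_eps: "\<forall>\<epsilon>. 0 < \<epsilon> \<and> \<epsilon> \<le> \<epsilon>0 \<longrightarrow> compact (minimizers_plus Z \<Psi> f \<epsilon>)"
  shows "minimizers_plus Z \<Psi> f 0 \<noteq> {} \<and> compact (minimizers_plus Z \<Psi> f 0)
      \<and> hausdorff_converges (\<lambda>\<epsilon>. minimizers_plus Z \<Psi> f \<epsilon>) (minimizers_plus Z \<Psi> f 0)
      \<and> ((\<forall>\<psi>\<in>\<Psi>. lower_semicontinuous (\<lambda>x. tri \<psi> (f x))) \<longrightarrow>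
           minimizers Z \<Psi> f 0 \<noteq> {} \<and> zero_solution Z \<Psi> f (minimizers Z \<Psi> f 0))"
proof (intro conjI impI)
  let ?K = "minimizers_plus Z \<Psi> f"
  have f: "f x \<in> closed_sets Z \<Psi>" for x
    using f_closed by blast
  have compact: "compact (?K e)" if "0 < e" "e \<le> \<epsilon>0" for e
    using compact_eps that by blast
  have mono: "?K d \<subseteq> ?K e" if "0 < d" "d \<le> e" for d e
    using that by (intro minimizers_plus_mono) auto
  show "?K 0 \<noteq> {}"
    unfolding minimizers_plus_zero_eq_Inter
    by (rule shrinking_compacts_Inter_nonempty[OF eps0 mono compact
          minimizers_plus_nonempty[OF f nonempty]])
  show "compact (?K 0)"
  proof -
    \<comment> \<open>Only members with \<open>\<epsilon> \<le> \<epsilon>0\<close> are known to be closed, so all are cut down to \<open>?K \<epsilon>0\<close>.\<close>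
    have "closed (?K e \<inter> ?K \<epsilon>0)" if "0 < e" for e
    proof -
      have "?K e \<inter> ?K \<epsilon>0 = ?K (min e \<epsilon>0)"
        using mono[of e \<epsilon>0] mono[of \<epsilon>0 e] that eps0 by (auto simp: min_def)
      then show ?thesis
        using compact[of "min e \<epsilon>0"] that eps0 by (simp add: compact_imp_closed)
    qed
    then have "closed (\<Inter>e\<in>{0<..}. ?K e \<inter> ?K \<epsilon>0)"
      by (intro closed_INT) simp
    moreover have "?K 0 = ?K \<epsilon>0 \<inter> (\<Inter>e\<in>{0<..}. ?K e \<inter> ?K \<epsilon>0)"
      unfolding minimizers_plus_zero_eq_Inter using eps0 by auto
    ultimately show ?thesis
      using compact[OF eps0 order_refl] by (simp only: compact_Int_closed)
  qed
  show "hausdorff_converges ?K (?K 0)"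
    unfolding minimizers_plus_zero_eq_Inter
    by (rule shrinking_compacts_hausdorff_converges[OF eps0 mono compact])
  assume lsc: "\<forall>\<psi>\<in>\<Psi>. lower_semicontinuous (\<lambda>x. tri \<psi> (f x))"
  have "\<exists>x. tri \<psi> (f x) \<le> bound Z \<Psi> f 0 \<psi>" if \<psi>: "\<psi> \<in> \<Psi>" for \<psi>
    using lower_semicontinuous_attains_bound_zero[OF f \<psi> bspec[OF lsc \<psi>] eps0 compact] by metis
  then show solution: "zero_solution Z \<Psi> f (minimizers Z \<Psi> f 0)"
    by (rule zero_solution_minimizersI[OF f nonempty])
  then show "minimizers Z \<Psi> f 0 \<noteq> {}"
    by (simp add: zero_solution_def)
qed

end
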